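(* Let $M[P,Q]$ be a connected lattice path matroid of rank $r$ with at least two elements. An element $x$ of $M[P,Q]$ is in a spanning circuit of $M[P,Q]$ if and only if $x$ is in at least two of the sets $N_1,\ldots,N_r$, or $x$ is in $N_1$ or in $N_r$.
   Context: Lattice paths start at $(0,0)$ and use steps $E=(1,0)$ and $N=(0,1)$. For lattice paths $P,Q$ from $(0,0)$ to $(m,r)$ with $P$ never going above $Q$, let $\mathcal{P}$ be the set of lattice paths from $(0,0)$ to $(m,r)$ going neither above $Q$ nor below $P$, and for $1\le i\le r$ let $N_i=\{j:\text{step } j \text{ is the } i\text{-th North step of some path in }\mathcal{P}\}$. $M[P,Q]$ is the transversal matroid on $[m+r]$ with presentation $(N_1,\ldots,N_r)$. A spanning circuit is a circuit that spans the matroid. *)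

theory Defs
  imports Main
begin

section \<open>Matroid notions\<close>

text \<open>A matroid is given by its ground set and its family of independent sets.
  The independence axioms are not part of the record.\<close>

record 'a matroid =
  ground :: "'a set"
  indeps :: "'a set set"

definition circuit :: "'a matroid \<Rightarrow> 'a set \<Rightarrow> bool" where
  "circuit M C \<longleftrightarrow> C \<subseteq> ground M \<and> C \<notin> indeps M \<and> (\<forall>D. D \<subset> C \<longrightarrow> D \<in> indeps M)"

definition rank_of :: "'a matroid \<Rightarrow> 'a set \<Rightarrow> nat" where
  "rank_of M X = Max {card I | I. I \<in> indeps M \<and> I \<subseteq> X}"

definition closure_of :: "'a matroid \<Rightarrow> 'a set \<Rightarrow> 'a set" where
  "closure_of M X = {x \<in> ground M. rank_of M (insert x X) = rank_of M X}"

definition spanning :: "'a matroid \<Rightarrow> 'a set \<Rightarrow> bool" where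
  "spanning M X \<longleftrightarrow> X \<subseteq> ground M \<and> closure_of M X = ground M"

definition connected_matroid :: "'a matroid \<Rightarrow> bool" where
  "connected_matroid M \<longleftrightarrow>
     (\<forall>x\<in>ground M. \<forall>y\<in>ground M. x \<noteq> y \<longrightarrow> (\<exists>C. circuit M C \<and> x \<in> C \<and> y \<in> C))"

text \<open>The independent sets are the partial transversals of the family \<open>(A i)\<close>, \<open>i \<in> I\<close>.\<close>

definition transversal_matroid :: "'a set \<Rightarrow> 'i set \<Rightarrow> ('i \<Rightarrow> 'a set) \<Rightarrow> 'a matroid" where
  "transversal_matroid S I A =
     \<lparr> ground = S,
       indeps = {X. X \<subseteq> S \<and> (\<exists>f. inj_on f X \<and> (\<forall>x\<in>X. f x \<in> I \<and> x \<in> A (f x)))} \<rparr>"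


section \<open>Lattice paths\<close>

datatype step = East | North

text \<open>A path from the origin is its list of steps.\<close>

type_synonym path = "step list"

definition path_end :: "path \<Rightarrow> nat \<times> nat" where
  "path_end R = (count_list R East, count_list R North)"

definition path_points :: "path \<Rightarrow> (nat \<times> nat) set" where
  "path_points R = {path_end (take k R) | k. k \<le> length R}"

text \<open>A path goes above (below) another one if one of its lattice points lies strictly
  above (below) every lattice point of the other path in the same column. Only paths with
  a common endpoint are compared, so each such column meets both paths.\<close>

definition goes_above :: "path \<Rightarrow> path \<Rightarrow> bool" where
  "goes_above R Q \<longleftrightarrow>
     (\<exists>a b. (a, b) \<in> path_points R \<and> (\<forall>b'. (a, b') \<in> path_points Q \<longrightarrow> b' < b))"

definition goes_below :: "path \<Rightarrow> path \<Rightarrow> bool" where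
  "goes_below R P \<longleftrightarrow>
     (\<exists>a b. (a, b) \<in> path_points R \<and> (\<forall>b'. (a, b') \<in> path_points P \<longrightarrow> b < b'))"

definition paths_between :: "nat \<Rightarrow> nat \<Rightarrow> path \<Rightarrow> path \<Rightarrow> path set" where
  "paths_between m r P Q =
     {R. path_end R = (m, r) \<and> \<not> goes_above R Q \<and> \<not> goes_below R P}"

text \<open>Steps are numbered from 1, whereas list positions start at 0.\<close>

definition ith_north_step :: "path \<Rightarrow> nat \<Rightarrow> nat \<Rightarrow> bool" where
  "ith_north_step R i j \<longleftrightarrow>
     1 \<le> j \<and> j \<le> length R \<and> R ! (j - 1) = North \<and> count_list (take j R) North = i"

definition north_set :: "nat \<Rightarrow> nat \<Rightarrow> path \<Rightarrow> path \<Rightarrow> nat \<Rightarrow> nat set" where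
  "north_set m r P Q i = {j. \<exists>R\<in>paths_between m r P Q. ith_north_step R i j}"

definition lattice_path_matroid :: "nat \<Rightarrow> nat \<Rightarrow> path \<Rightarrow> path \<Rightarrow> nat matroid" where
  "lattice_path_matroid m r P Q = transversal_matroid {1..m + r} {1..r} (north_set m r P Q)"

end

theory Submission
  imports Defs
begin

text \<open>The sets \<open>N\<^sub>i\<close> are intervals \<open>[a\<^sub>i, b\<^sub>i]\<close> with both endpoints strictly increasing in \<open>i\<close>,
  and connectivity forces consecutive ones to overlap: if \<open>b\<^sub>i < a\<^sub>i\<^sub>+\<^sub>1\<close>, the matroid splits at \<open>b\<^sub>i\<close>.
  A spanning circuit is a circuit with \<open>r + 1\<close> elements. If \<open>x \<in> N\<^sub>i \<inter> N\<^sub>i\<^sub>+\<^sub>1\<close>, then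
  \<open>a\<^sub>1 < \<dots> < a\<^sub>i < x < b\<^sub>i\<^sub>+\<^sub>1 < \<dots> < b\<^sub>r\<close> is one, since on deleting any entry the earlier entries
  represent \<open>N\<^sub>1, N\<^sub>2, \<dots>\<close> and the later ones represent \<open>\<dots>, N\<^sub>r\<close>.
  Conversely, let \<open>x\<close> be only in \<open>N\<^sub>i\<close>, with \<open>1 < i < r\<close>. Elements below \<open>x\<close> lie only in
  \<open>N\<^sub>1, \<dots>, N\<^sub>i\<close> and those above \<open>x\<close> only in \<open>N\<^sub>i, \<dots>, N\<^sub>r\<close>. In a circuit with \<open>r + 1\<close> elements
  through \<open>x\<close>, the elements on one side of \<open>x\<close>, taken together with \<open>x\<close>, then outnumber the sets
  available to them; so deleting an element from the other side leaves a dependent set.\<close>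

section \<open>Spanning circuits of transversal matroids\<close>

lemma ground_transversal [simp]: "ground (transversal_matroid S I A) = S"
  by (simp add: transversal_matroid_def)

lemma indeps_transversal_iff:
  "X \<in> indeps (transversal_matroid S I A) \<longleftrightarrow>
     X \<subseteq> S \<and> (\<exists>f. inj_on f X \<and> (\<forall>x\<in>X. f x \<in> I \<and> x \<in> A (f x)))"
  by (simp add: transversal_matroid_def)

lemma transversal_matroid_cong:
  assumes "\<And>i. i \<in> I \<Longrightarrow> A i = B i"
  shows "transversal_matroid S I A = transversal_matroid S I B"
proof -
  have "(f x \<in> I \<and> x \<in> A (f x)) = (f x \<in> I \<and> x \<in> B (f x))" for f :: "'b \<Rightarrow> 'a" and x
    using assms by auto
  then show ?thesis by (simp add: transversal_matroid_def)
qed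

lemma indep_transversal_subset:
  assumes "X \<in> indeps (transversal_matroid S I A)" "Y \<subseteq> X"
  shows "Y \<in> indeps (transversal_matroid S I A)"
  using assms unfolding indeps_transversal_iff by (meson inj_on_subset subset_eq)

lemma indep_transversal_image:
  assumes "c ` K \<subseteq> S" "inj_on c K" "inj_on g K" "\<And>k. k \<in> K \<Longrightarrow> g k \<in> I \<and> c k \<in> A (g k)"
  shows "c ` K \<in> indeps (transversal_matroid S I A)"
proof -
  have "inj_on (g \<circ> inv_into K c) (c ` K)"
    using assms(3) by (intro comp_inj_on inj_on_inv_into) (simp_all add: inj_on_subset assms(2))
  moreover have "\<forall>x \<in> c ` K. (g \<circ> inv_into K c) x \<in> I \<and> x \<in> A ((g \<circ> inv_into K c) x)"
    using assms(2,4) by simp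
  ultimately show ?thesis using assms(1) unfolding indeps_transversal_iff by blast
qed

text \<open>The easy half of Hall's condition: a matching maps \<open>Y\<close> injectively into
  \<open>J\<close>.\<close>

lemma indep_transversal_card_le:
  assumes "X \<in> indeps (transversal_matroid S I A)" "finite J" "Y \<subseteq> X"
    and "\<And>y i. y \<in> Y \<Longrightarrow> i \<in> I \<Longrightarrow> y \<in> A i \<Longrightarrow> i \<in> J"
  shows "card Y \<le> card J"
proof -
  obtain f where f: "inj_on f X" "\<forall>x\<in>X. f x \<in> I \<and> x \<in> A (f x)"
    using assms(1) unfolding indeps_transversal_iff by blast
  have "inj_on f Y" using f(1) assms(3) by (rule inj_on_subset)
  moreover have "f ` Y \<subseteq> J" using f(2) assms(3,4) by blast
  ultimately show ?thesis using assms(2) by (rule card_inj_on_le)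
qed

text \<open>Augmentation along an alternating path. It serves to show that fewer than
  \<open>card I\<close> independent elements cannot span.\<close>

lemma indep_transversal_augment:
  assumes fin: "finite S" "finite I"
    and b: "inj_on b I" "\<And>i. i \<in> I \<Longrightarrow> b i \<in> S \<inter> A i"
    and X: "X \<in> indeps (transversal_matroid S I A)" and less: "card X < card I"
  obtains i where "i \<in> I" "b i \<notin> X" "insert (b i) X \<in> indeps (transversal_matroid S I A)"
proof -
  have XS: "X \<subseteq> S" using X unfolding indeps_transversal_iff by blast
  then have finX: "finite X" using fin finite_subset by blast
  \<comment> \<open>Moving an element \<open>b i\<close> of \<open>X\<close> to an unused index \<open>i\<close> lowers the number of indices at which
    \<open>f\<close> disagrees with \<open>b\<close>.\<close>
  have "\<exists>i\<in>I. b i \<notin> X \<and> insert (b i) X \<in> indeps (transversal_matroid S I A)"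
    if "inj_on f X" "\<forall>x\<in>X. f x \<in> I \<and> x \<in> A (f x)" for f
    using that
  proof (induction "card {x \<in> X. b (f x) \<noteq> x}" arbitrary: f rule: less_induct)
    case (less f)
    have "card (f ` X) < card I"
      using less.prems(1) \<open>card X < card I\<close> by (simp add: card_image)
    then have "\<not> I \<subseteq> f ` X" using finX by (meson card_mono finite_imageI not_less)
    then obtain i where i: "i \<in> I" "i \<notin> f ` X" by blast
    show ?case
    proof (cases "b i \<in> X")
      case False
      have "inj_on (f(b i := i)) (insert (b i) X)"
        using less.prems(1) i(2) False by (auto simp: inj_on_def)
      moreover have "\<forall>x\<in>insert (b i) X. (f(b i := i)) x \<in> I \<and> x \<in> A ((f(b i := i)) x)"
        using less.prems(2) i(1) b(2) by auto
      moreover have "insert (b i) X \<subseteq> S" using XS i(1) b(2) by auto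
      ultimately show ?thesis using i(1) False unfolding indeps_transversal_iff by blast
    next
      case True
      let ?g = "f(b i := i)"
      have g: "inj_on ?g X" "\<forall>x\<in>X. ?g x \<in> I \<and> x \<in> A (?g x)"
        using less.prems i b(2) by (auto simp: inj_on_def)
      \<comment> \<open>The index \<open>f (b i)\<close> is used and \<open>i\<close> is not, so
        they differ; as \<open>b\<close> is injective, \<open>b i\<close> is a disagreement of
        \<open>f\<close>, which \<open>?g\<close> removes.\<close>
      have "b (f (b i)) \<noteq> b i"
        using b(1) i less.prems(2) True unfolding inj_on_def by (metis imageI)
      then have "{x \<in> X. b (?g x) \<noteq> x} \<subset> {x \<in> X. b (f x) \<noteq> x}" using True by auto
      then have "card {x \<in> X. b (?g x) \<noteq> x} < card {x \<in> X. b (f x) \<noteq> x}"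
        using finX by (simp add: psubset_card_mono)
      from less.hyps[OF this g] show ?thesis .
    qed
  qed
  then show thesis using X that unfolding indeps_transversal_iff by blast
qed

section \<open>Rank and the size of spanning circuits\<close>

lemma card_indep_le_rank_of:
  assumes "finite X" "Y \<in> indeps M" "Y \<subseteq> X"
  shows "card Y \<le> rank_of M X"
proof -
  have "{card I | I. I \<in> indeps M \<and> I \<subseteq> X} \<subseteq> card ` Pow X" by blast
  then have "finite {card I | I. I \<in> indeps M \<and> I \<subseteq> X}"
    using assms(1) finite_subset by blast
  then show ?thesis unfolding rank_of_def using assms(2,3) by (intro Max_ge) blast+
qed

lemma rank_of_le:
  assumes "finite X" "{} \<in> indeps M" "\<And>Y. Y \<in> indeps M \<Longrightarrow> Y \<subseteq> X \<Longrightarrow> card Y \<le> k"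
  shows "rank_of M X \<le> k"
proof -
  have "{card I | I. I \<in> indeps M \<and> I \<subseteq> X} \<subseteq> card ` Pow X" by blast
  then have "finite {card I | I. I \<in> indeps M \<and> I \<subseteq> X}"
    using assms(1) finite_subset by blast
  moreover have "{card I | I. I \<in> indeps M \<and> I \<subseteq> X} \<noteq> {}" using assms(2) by blast
  ultimately show ?thesis unfolding rank_of_def using assms(3) by (auto simp: Max_le_iff)
qed

lemma rank_of_circuit:
  assumes "circuit M C" "finite C" "{} \<in> indeps M"
  shows "Suc (rank_of M C) = card C"
proof -
  have "C \<noteq> {}" using assms(1,3) unfolding circuit_def by blast
  then obtain c where c: "c \<in> C" by blast
  have "C - {c} \<in> indeps M" using assms(1) c unfolding circuit_def by blast
  then have "card (C - {c}) \<le> rank_of M C" using assms(2) by (intro card_indep_le_rank_of) auto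
  moreover have "rank_of M C \<le> card C - 1"
  proof (rule rank_of_le)
    fix Y assume "Y \<in> indeps M" "Y \<subseteq> C"
    then have "Y \<subset> C" using assms(1) unfolding circuit_def by blast
    then have "card Y < card C" using assms(2) by (rule psubset_card_mono[rotated])
    then show "card Y \<le> card C - 1" by simp
  qed (use assms in auto)
  moreover have "card C > 0" using c assms(2) card_gt_0_iff by blast
  ultimately show ?thesis using c assms(2) by simp
qed

text \<open>The transversal \<open>b\<close> makes the rank \<open>card I\<close>, and a circuit has
  rank one less than its size. If that is too small, augmenting \<open>C - {c}\<close> by some
  \<open>b i\<close> puts \<open>b i\<close> outside the closure of \<open>C\<close>.\<close>

lemma spanning_circuit_transversal_iff:
  assumes fin: "finite S" "finite I"
    and b: "inj_on b I" "\<And>i. i \<in> I \<Longrightarrow> b i \<in> S \<inter> A i"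
    and C: "circuit (transversal_matroid S I A) C"
  shows "spanning (transversal_matroid S I A) C \<longleftrightarrow> card C = Suc (card I)"
proof -
  let ?M = "transversal_matroid S I A"
  have CS: "C \<subseteq> S" using C by (simp add: circuit_def)
  then have finC: "finite C" using fin finite_subset by blast
  have empty: "{} \<in> indeps ?M" by (simp add: indeps_transversal_iff)
  have rank: "Suc (rank_of ?M C) = card C" using rank_of_circuit[OF C finC empty] .
  have le: "card Y \<le> card I" if "Y \<in> indeps ?M" for Y
    using indep_transversal_card_le[OF that fin(2) subset_refl] by blast
  have rank_le: "rank_of ?M C \<le> card I"
    using rank_of_le[OF finC empty] le by blast
  show ?thesis
  proof
    assume span: "spanning ?M C"
    show "card C = Suc (card I)"
    proof (rule ccontr)
      assume "card C \<noteq> Suc (card I)"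
      then have less: "rank_of ?M C < card I" using rank rank_le by linarith
      have "C \<noteq> {}" using rank by auto
      then obtain c where c: "c \<in> C" by blast
      have ind: "C - {c} \<in> indeps ?M" using C c unfolding circuit_def by blast
      have card_c: "card (C - {c}) = rank_of ?M C" using c finC rank by simp
      then have card_less: "card (C - {c}) < card I" using less by simp
      obtain i where i: "i \<in> I" "b i \<notin> C - {c}" "insert (b i) (C - {c}) \<in> indeps ?M"
        using indep_transversal_augment[OF fin b ind card_less] by blast
      have "Suc (rank_of ?M C) = card (insert (b i) (C - {c}))"
        using i(2) finC card_c by simp
      also have "\<dots> \<le> rank_of ?M (insert (b i) C)"
        using finC i(3) by (intro card_indep_le_rank_of) auto
      also have "\<dots> = rank_of ?M C"
        using span i(1) b(2) unfolding spanning_def closure_of_def by auto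
      finally show False by simp
    qed
  next
    assume "card C = Suc (card I)"
    then have r: "rank_of ?M C = card I" using rank by simp
    have "rank_of ?M (insert y C) = rank_of ?M C" for y
    proof (rule antisym)
      show "rank_of ?M (insert y C) \<le> rank_of ?M C"
        unfolding r using finC empty le by (intro rank_of_le) auto
      have "C \<noteq> {}" using rank by auto
      then obtain c where c: "c \<in> C" by blast
      have "C - {c} \<in> indeps ?M" using C c unfolding circuit_def by blast
      then have "card (C - {c}) \<le> rank_of ?M (insert y C)"
        using finC by (intro card_indep_le_rank_of) auto
      then show "rank_of ?M C \<le> rank_of ?M (insert y C)" using rank c finC by simp
    qed
    then show "spanning ?M C" using CS unfolding spanning_def closure_of_def by simp
  qed
qed

section \<open>Consequences of connectivity\<close>

lemma connected_transversal_loopless: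
  assumes "connected_matroid (transversal_matroid S I A)" "y \<in> S" "z \<in> S" "y \<noteq> z"
  shows "\<exists>i\<in>I. y \<in> A i"
proof -
  obtain C where C: "circuit (transversal_matroid S I A) C" "y \<in> C" "z \<in> C"
    using assms unfolding connected_matroid_def by auto
  \<comment> \<open>The second element \<open>z\<close> makes \<open>{y}\<close> a proper subset of
    a circuit; a one-element matroid is connected even if its element is a loop.\<close>
  then have "{y} \<in> indeps (transversal_matroid S I A)"
    using assms(4) unfolding circuit_def by blast
  then show ?thesis unfolding indeps_transversal_iff by blast
qed

text \<open>No index serves elements on both sides of \<open>T\<close>, so matchings of the proper
  subsets \<open>C \<inter> T\<close> and \<open>C - T\<close> of a circuit \<open>C\<close> glue to
  a matching of \<open>C\<close>.\<close>

lemma connected_transversal_no_split: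
  assumes conn: "connected_matroid (transversal_matroid S I A)"
    and "y \<in> S \<inter> T" "z \<in> S - T"
    and split: "\<And>u v i j. u \<in> S \<inter> T \<Longrightarrow> v \<in> S - T \<Longrightarrow> i \<in> I \<Longrightarrow> j \<in> I \<Longrightarrow> u \<in> A i \<Longrightarrow> v \<in> A j \<Longrightarrow> i \<noteq> j"
  shows False
proof -
  let ?M = "transversal_matroid S I A"
  obtain C where C: "circuit ?M C" "y \<in> C" "z \<in> C"
    using conn assms(2,3) unfolding connected_matroid_def by force
  have CS: "C \<subseteq> S" using C(1) by (simp add: circuit_def)
  have "C \<inter> T \<in> indeps ?M" "C - T \<in> indeps ?M"
    using C assms(2,3) unfolding circuit_def by blast+
  then obtain f g where
    f: "inj_on f (C \<inter> T)" "\<forall>x\<in>C \<inter> T. f x \<in> I \<and> x \<in> A (f x)" and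
    g: "inj_on g (C - T)" "\<forall>x\<in>C - T. g x \<in> I \<and> x \<in> A (g x)"
    unfolding indeps_transversal_iff by blast
  let ?h = "\<lambda>x. if x \<in> T then f x else g x"
  have ne: "f u \<noteq> g v" if "u \<in> C" "u \<in> T" "v \<in> C" "v \<notin> T" for u v
    using split[of u v "f u" "g v"] f(2) g(2) that CS by blast
  have "u = v" if "u \<in> C" "v \<in> C" "?h u = ?h v" for u v
    using that ne[of u v] ne[of v u] f(1) g(1)
    by (cases "u \<in> T"; cases "v \<in> T") (auto dest: inj_onD)
  then have "inj_on ?h C" by (rule inj_onI)
  moreover have "\<forall>x\<in>C. ?h x \<in> I \<and> x \<in> A (?h x)" using f(2) g(2) by auto
  ultimately have "C \<in> indeps ?M" using CS unfolding indeps_transversal_iff by blast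
  then show False using C(1) unfolding circuit_def by blast
qed

lemma chain_spanning_circuit:
  fixes c :: "nat \<Rightarrow> 'a" and A :: "nat \<Rightarrow> 'a set"
  assumes "finite S" and c: "inj_on c {0..r}" "c ` {0..r} \<subseteq> S"
    and left: "\<And>k. k \<in> {1..r} \<Longrightarrow> c k \<in> A k"
    and right: "\<And>k. k < r \<Longrightarrow> c k \<in> A (Suc k)"
  defines "M \<equiv> transversal_matroid S {1..r} A"
  shows "circuit M (c ` {0..r}) \<and> spanning M (c ` {0..r})"
proof -
  have card: "card (c ` {0..r}) = Suc r" using c(1) by (simp add: card_image)
  have dep: "c ` {0..r} \<notin> indeps M"
    using indep_transversal_card_le[of "c ` {0..r}" S "{1..r}" A "{1..r}" "c ` {0..r}"] card
    unfolding M_def by auto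
  have "D \<in> indeps M" if D: "D \<subset> c ` {0..r}" for D
  proof -
    obtain z where "z \<in> c ` {0..r} - D" using psubset_imp_ex_mem[OF D] by blast
    then obtain k where k: "k \<le> r" "c k \<notin> D" by auto
    \<comment> \<open>Entries before the gap \<open>k\<close> take the next set, those after it keep
      their own; the indices used are exactly \<open>1..r\<close>.\<close>
    let ?K = "{0..r} - {k}" and ?g = "\<lambda>l. if l < k then Suc l else l"
    have "c ` ?K \<in> indeps M" unfolding M_def
    proof (rule indep_transversal_image)
      show "inj_on ?g ?K" by (auto simp: inj_on_def split: if_splits)
      show "inj_on c ?K" using c(1) by (rule inj_on_subset) auto
      show "?g l \<in> {1..r} \<and> c l \<in> A (?g l)" if "l \<in> ?K" for l
        using that k(1) left[of l] right[of l] by auto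
    qed (use c(2) in blast)
    moreover have "D \<subseteq> c ` ?K" using D k(2) by auto
    ultimately show ?thesis unfolding M_def by (rule indep_transversal_subset)
  qed
  then have circ: "circuit M (c ` {0..r})"
    using dep c(2) unfolding circuit_def M_def by simp
  \<comment> \<open>Without its entry 0 the chain is a transversal, as the size criterion
    requires.\<close>
  have "inj_on c {1..r}" using c(1) by (rule inj_on_subset) auto
  moreover have "c i \<in> S \<inter> A i" if "i \<in> {1..r}" for i using that left c(2) by auto
  ultimately show ?thesis
    using spanning_circuit_transversal_iff[of S "{1..r}" c A] assms(1) circ card
    unfolding M_def by simp
qed

section \<open>Interval presentations\<close>

text \<open>Only the order of the endpoints matters until the paths return in the final
  interpretation, where \<open>a\<close> lists the North steps of the upper path \<open>Q\<close>
  and \<open>b\<close> those of \<open>P\<close>.\<close>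

locale interval_presentation =
  fixes n r :: nat and a b :: "nat \<Rightarrow> nat"
  assumes a_less: "1 \<le> i \<Longrightarrow> i < j \<Longrightarrow> j \<le> r \<Longrightarrow> a i < a j"
    and b_less: "1 \<le> i \<Longrightarrow> i < j \<Longrightarrow> j \<le> r \<Longrightarrow> b i < b j"
    and a_le_b: "1 \<le> i \<Longrightarrow> i \<le> r \<Longrightarrow> a i \<le> b i"
    and a_pos: "1 \<le> i \<Longrightarrow> i \<le> r \<Longrightarrow> 1 \<le> a i"
    and b_le: "1 \<le> i \<Longrightarrow> i \<le> r \<Longrightarrow> b i \<le> n"
begin

definition M :: "nat matroid" where
  "M = transversal_matroid {1..n} {1..r} (\<lambda>i. {a i..b i})"

lemma spanning_circuit_iff_card:
  assumes "circuit M C"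
  shows "spanning M C \<longleftrightarrow> card C = Suc r"
proof -
  have "inj_on b {1..r}"
    by (rule linorder_inj_onI) (use b_less in \<open>auto dest: less_imp_neq\<close>)
  moreover have "b i \<in> {1..n} \<inter> {a i..b i}" if "i \<in> {1..r}" for i
    using that a_pos[of i] a_le_b[of i] b_le[of i] by auto
  ultimately show ?thesis
    using spanning_circuit_transversal_iff[of "{1..n}" "{1..r}" b "\<lambda>i. {a i..b i}" C] assms
    unfolding M_def by simp
qed

section \<open>Elements in no spanning circuit\<close>

lemma only_inner_not_in_spanning_circuit:
  assumes i: "1 < i" "i < r" "x \<in> {a i..b i}"
    and only: "\<And>j. j \<in> {1..r} \<Longrightarrow> x \<in> {a j..b j} \<Longrightarrow> j = i"
    and C: "circuit M C" "spanning M C" "x \<in> C"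
  shows False
proof -
  have CS: "C \<subseteq> {1..n}" using C(1) by (simp add: circuit_def M_def)
  then have finC: "finite C" by (rule finite_subset) simp
  have card: "card C = Suc r" using C spanning_circuit_iff_card by blast
  define L where "L = {y \<in> C. y < x}"
  define U where "U = {y \<in> C. x < y}"
  have C_eq: "C = insert x (L \<union> U)" using C(3) by (auto simp: L_def U_def)
  have fin: "finite L" "finite U" using finC by (auto simp: L_def U_def)
  have LU: "card L + card U = r"
  proof -
    have "card (L \<union> U) = card L + card U"
      using fin by (intro card_Un_disjoint) (auto simp: L_def U_def)
    moreover have "card C = Suc (card (L \<union> U))"
      unfolding C_eq using fin by (intro card_insert_disjoint) (auto simp: L_def U_def)
    ultimately show ?thesis using card by simp
  qed
  \<comment> \<open>If \<open>i < j\<close>, then \<open>a j \<le> y \<le> x \<le> b i < b j\<close>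
    puts \<open>x\<close> into the interval of \<open>j\<close>, against \<open>only\<close>. The
    claim \<open>above\<close> is the mirror image.\<close>
  have below: "j \<in> {1..i}" if "y \<le> x" "j \<in> {1..r}" "y \<in> {a j..b j}" for y j
    using that only[of j] i b_less[of i j] by (cases "i < j") auto
  have above: "j \<in> {i..r}" if "x \<le> y" "j \<in> {1..r}" "y \<in> {a j..b j}" for y j
    using that only[of j] i a_less[of j i] by (cases "j < i") auto
  have ind: "C - {c} \<in> indeps M" if "c \<in> C" for c
    using C(1) that unfolding circuit_def by blast
  have low: "card Y \<le> i" if "Y \<subseteq> C - {c}" "c \<in> C" "\<And>y. y \<in> Y \<Longrightarrow> y \<le> x" for Y c
  proof -
    have "card Y \<le> card {1..i}"
      by (rule indep_transversal_card_le[OF ind[OF that(2), unfolded M_def] finite_atLeastAtMost that(1)])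
        (use that(3) below in blast)
    then show ?thesis by simp
  qed
  have up: "card Y \<le> Suc r - i" if "Y \<subseteq> C - {c}" "c \<in> C" "\<And>y. y \<in> Y \<Longrightarrow> x \<le> y" for Y c
  proof -
    have "card Y \<le> card {i..r}"
      by (rule indep_transversal_card_le[OF ind[OF that(2), unfolded M_def] finite_atLeastAtMost that(1)])
        (use that(3) above in blast)
    then show ?thesis by simp
  qed
  \<comment> \<open>The bounds \<open>i\<close> and \<open>r + 1 - i\<close> add up to
    \<open>r + 1\<close> but the sizes to \<open>r\<close>, so exactly one bound is
    attained.\<close>
  have "card L \<le> i" using low[of L x] C(3) by (auto simp: L_def)
  moreover have "card U \<le> Suc r - i" using up[of U x] C(3) by (auto simp: U_def)
  ultimately consider "card L = i" "card U = r - i" | "card L = i - 1" "card U = Suc r - i"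
    using LU i by linarith
  then show False
  proof cases
    case 1
    \<comment> \<open>Here \<open>i < r\<close> provides an element above \<open>x\<close>. Deleting
      it leaves \<open>insert x L\<close> independent, although it has \<open>i + 1\<close> elements
      for \<open>i\<close> sets. The other case is symmetric and uses \<open>1 < i\<close>.\<close>
    then have "card U > 0" using i by simp
    then obtain c where c: "c \<in> U" by (metis all_not_in_conv card.empty less_irrefl)
    have "card (insert x L) \<le> i"
      using c C(3) by (intro low[of _ c]) (auto simp: L_def U_def)
    moreover have "card (insert x L) = Suc (card L)" using fin by (simp add: L_def)
    ultimately show False using 1 by simp
  next
    case 2
    then have "card L > 0" using i by simp
    then obtain c where c: "c \<in> L" by (metis all_not_in_conv card.empty less_irrefl)
    have "card (insert x U) \<le> Suc r - i"
      using c C(3) by (intro up[of _ c]) (auto simp: L_def U_def)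
    moreover have "card (insert x U) = Suc (card U)" using fin by (simp add: U_def)
    ultimately show False using 2 by simp
  qed
qed

section \<open>Overlapping intervals and chain circuits\<close>

lemma connected_overlap:
  assumes "connected_matroid M" "1 \<le> i" "i < r"
  shows "a (Suc i) \<le> b i"
proof (rule ccontr)
  assume gap: "\<not> a (Suc i) \<le> b i"
  \<comment> \<open>The element \<open>b (Suc i)\<close> shows that the ground set continues beyond
    the cut at \<open>b i\<close>.\<close>
  have "b i < b (Suc i)" "b (Suc i) \<le> n" "1 \<le> b i"
    using assms b_less[of i "Suc i"] b_le[of "Suc i"] a_pos[of i] a_le_b[of i] by auto
  then have "b i \<in> {1..n} \<inter> {..b i}" "Suc (b i) \<in> {1..n} - {..b i}" by auto
  moreover have "j \<noteq> k" if "u \<in> {1..n} \<inter> {..b i}" "v \<in> {1..n} - {..b i}" "j \<in> {1..r}" "k \<in> {1..r}"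
    "u \<in> {a j..b j}" "v \<in> {a k..b k}" for u v j k
  proof -
    \<comment> \<open>If \<open>j > i\<close>, then \<open>a j \<ge> a (Suc i) > b i\<close>, so the
      interval of \<open>j\<close> misses the lower side; if \<open>k \<le> i\<close>, then
      \<open>b k \<le> b i\<close>, so that of \<open>k\<close> misses the upper side.\<close>
    have "j \<le> i" using that gap a_less[of "Suc i" j] assms(2,3) by (cases "j = Suc i"; cases "j \<le> i") auto
    moreover have "\<not> k \<le> i" using that b_less[of k i] assms(2,3) by (cases "k = i") auto
    ultimately show ?thesis by blast
  qed
  ultimately show False
    using connected_transversal_no_split[of "{1..n}" "{1..r}" "\<lambda>i. {a i..b i}" "b i" "{..b i}"] assms(1)
    unfolding M_def by blast
qed

text \<open>Here \<open>x\<close> becomes the entry of index \<open>i\<close>, counted from 0.\<close>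

lemma spanning_circuit_through:
  assumes overlap: "\<And>k. 1 \<le> k \<Longrightarrow> k < r \<Longrightarrow> a (Suc k) \<le> b k"
    and i: "i \<le> r" "1 \<le> r"
    and x: "i < r \<Longrightarrow> a (Suc i) \<le> x" "1 \<le> i \<Longrightarrow> x \<le> b i" "i = 0 \<Longrightarrow> x < b 1" "i = r \<Longrightarrow> a r < x"
  shows "\<exists>C. circuit M C \<and> spanning M C \<and> x \<in> C"
proof -
  define c where "c k = (if k < i then a (Suc k) else if k = i then x else b k)" for k
  \<comment> \<open>Together, \<open>lower\<close> and \<open>upper\<close> put each inner entry
    into two consecutive intervals. For an entry that is an endpoint, one bound is trivial and
    \<open>overlap\<close> gives the other.\<close>
  have lower: "a (Suc k) \<le> c k" if "k < r" for k
    using that x(1) overlap[of k] by (auto simp: c_def)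
  have upper: "c k \<le> b k" if "1 \<le> k" "k \<le> r" for k
    using that x(2) i overlap[of k] by (auto simp: c_def)
  have left: "c k \<in> {a k..b k}" if "k \<in> {1..r}" for k
  proof (cases "k < r")
    case True
    then show ?thesis using that lower[of k] upper[of k] a_less[of k "Suc k"] by auto
  next
    case False
    then have "k = r" using that by simp
    then show ?thesis using that upper[of r] x(4) i(1) a_le_b[of r] by (auto simp: c_def)
  qed
  have right: "c k \<in> {a (Suc k)..b (Suc k)}" if "k < r" for k
  proof (cases "k = 0")
    case True
    then show ?thesis using that lower[of 0] x(3) a_le_b[of 1] by (auto simp: c_def)
  next
    case False
    then show ?thesis using that lower[of k] upper[of k] b_less[of k "Suc k"] by auto
  qed
  have step: "c k < c (Suc k)" if "k < r" for k
  proof -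
    consider "Suc k < i" | "Suc k = i" | "k = i" | "i < k" by linarith
    then show ?thesis
    proof cases
      case 1
      then show ?thesis using a_less[of "Suc k" "Suc (Suc k)"] i by (simp add: c_def)
    next
      case 2
      \<comment> \<open>For \<open>i < r\<close> strictness comes from
        \<open>a i < a (Suc i) \<le> x\<close>. For \<open>i = r\<close> there is no next interval,
        hence the separate hypothesis \<open>a r < x\<close>; likewise \<open>x < b 1\<close> for
        \<open>i = 0\<close>.\<close>
      then have "a i < x" using x(1,4) i a_less[of i "Suc i"] by (cases "i = r") auto
      then show ?thesis using 2 by (auto simp: c_def)
    next
      case 3
      then have "x < b (Suc i)" using that x(2,3) b_less[of i "Suc i"] by (cases "i = 0") auto
      then show ?thesis using 3 by (simp add: c_def)
    next
      case 4
      then show ?thesis using that b_less[of k "Suc k"] by (simp add: c_def)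
    qed
  qed
  have mono: "c k < c l" if "k < l" "l \<le> r" for k l
    using that
  proof (induction l)
    case (Suc l)
    then show ?case using step[of l] by (cases "k = l") auto
  qed simp
  have inj: "inj_on c {0..r}"
    by (rule linorder_inj_onI) (use mono in \<open>auto dest: less_imp_neq\<close>)
  have "c k \<in> {1..n}" if "k \<le> r" for k
  proof (cases "k = 0")
    case True
    then show ?thesis using right[of 0] i a_pos[of 1] b_le[of 1] by auto
  next
    case False
    then show ?thesis using left[of k] that a_pos[of k] b_le[of k] by auto
  qed
  then have sub: "c ` {0..r} \<subseteq> {1..n}" by auto
  have "circuit M (c ` {0..r}) \<and> spanning M (c ` {0..r})"
    unfolding M_def
    by (rule chain_spanning_circuit) (use inj sub left right in auto)
  moreover have "x \<in> c ` {0..r}" using i(1) by (auto simp: c_def image_iff intro!: bexI[of _ i])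
  ultimately show ?thesis by blast
qed

text \<open>The conjunct \<open>1 \<le> r\<close> guards the endpoints of index 1 and
  \<open>r\<close>, on which the locale assumes nothing when \<open>r = 0\<close>.\<close>

theorem in_spanning_circuit_iff:
  assumes conn: "connected_matroid M" and n: "2 \<le> n" and x: "x \<in> {1..n}"
  shows "(\<exists>C. circuit M C \<and> spanning M C \<and> x \<in> C) \<longleftrightarrow>
    card {i \<in> {1..r}. x \<in> {a i..b i}} \<ge> 2 \<or> 1 \<le> r \<and> (x \<in> {a 1..b 1} \<or> x \<in> {a r..b r})"
    (is "?lhs \<longleftrightarrow> ?rhs")
proof -
  have loopless: "\<exists>i\<in>{1..r}. y \<in> {a i..b i}" if "y \<in> {1..n}" for y
  proof -
    have "(if y = 1 then 2 else 1) \<in> {1..n}" "y \<noteq> (if y = 1 then 2 else 1)" using n by auto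
    then show ?thesis
      using connected_transversal_loopless[of "{1..n}" "{1..r}" "\<lambda>i. {a i..b i}" y] conn that
      unfolding M_def by blast
  qed
  have r: "1 \<le> r" using loopless[OF x] by auto
  \<comment> \<open>Elements 1 and 2 are not loops, so a single interval contains both.\<close>
  have a1b1: "a 1 < b 1" if "r = 1"
    using loopless[of 1] loopless[of 2] n that by auto
  note overlap = connected_overlap[OF conn]
  note through = spanning_circuit_through[OF overlap _ r]
  have inner: ?lhs if "1 \<le> i" "i < r" "a (Suc i) \<le> x" "x \<le> b i" for i
    using through[of i x] that by auto
  show ?thesis
  proof
    assume ?lhs
    then obtain C where C: "circuit M C" "spanning M C" "x \<in> C" by blast
    show ?rhs
    proof (rule ccontr)
      assume neg: "\<not> ?rhs"
      obtain i where i: "i \<in> {1..r}" "x \<in> {a i..b i}" using loopless[OF x] by blast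
      have inner: "1 < i" "i < r" using i neg r by (auto simp: order.order_iff_strict)
      have "j = i" if "j \<in> {1..r}" "x \<in> {a j..b j}" for j
      proof (rule ccontr)
        assume "j \<noteq> i"
        then have "card {i, j} = 2" by simp
        moreover have "card {i, j} \<le> card {i \<in> {1..r}. x \<in> {a i..b i}}"
          using i that by (intro card_mono) auto
        ultimately show False using neg by simp
      qed
      then show False
        using only_inner_not_in_spanning_circuit[OF inner i(2) _ C] by blast
    qed
  next
    assume ?rhs
    then consider "card {i \<in> {1..r}. x \<in> {a i..b i}} \<ge> 2" | "x \<in> {a 1..b 1}" | "x \<in> {a r..b r}"
      by blast
    then show ?lhs
    proof cases
      case 1
      let ?T = "{i \<in> {1..r}. x \<in> {a i..b i}}"
      have "\<not> card ?T \<le> Suc 0" "finite ?T" using 1 by simp_all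
      then have "\<exists>i\<in>?T. \<exists>j\<in>?T. i \<noteq> j" by (simp only: card_le_Suc0_iff_eq) blast
      then obtain i j where ij: "i \<in> ?T" "j \<in> ?T" "i < j" by (elim bexE linorder_neqE_nat)
      \<comment> \<open>Two intervals containing \<open>x\<close> may be taken consecutive:
        \<open>a (Suc i) \<le> a j \<le> x \<le> b i\<close>.\<close>
      have "a (Suc i) \<le> a j" using ij a_less[of "Suc i" j] by (cases "Suc i = j") auto
      then show ?thesis using ij by (intro inner[of i]) auto
    next
      case 2
      \<comment> \<open>If \<open>x < b 1\<close>, then \<open>x\<close> starts the chain
        \<open>x, b 1, ..., b r\<close>. If \<open>x = b 1\<close>, it lies in the second interval
        by \<open>overlap\<close>, or \<open>r = 1\<close> and \<open>a 1, x\<close> is the chain.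
        Case 3 is symmetric.\<close>
      show ?thesis
      proof (cases "x < b 1")
        case True
        then show ?thesis using through[of 0 x] 2 r by auto
      next
        case False
        then have "x = b 1" using 2 by simp
        then show ?thesis
          using through[of 1 x] a1b1 inner[of 1] overlap[of 1] r by (cases "r = 1") auto
      qed
    next
      case 3
      show ?thesis
      proof (cases "a r < x")
        case True
        then show ?thesis using through[of r x] 3 r by auto
      next
        case False
        then have x: "x = a r" using 3 by simp
        show ?thesis
        proof (cases "r = 1")
          case True
          then show ?thesis using through[of 0 x] a1b1 x by auto
        next
          case False
          then show ?thesis using inner[of "r - 1"] overlap[of "r - 1"] r x by auto
        qed
      qed
    qed
  qed
qed

end

section \<open>Heights of lattice paths\<close>

text \<open>Heights compare paths after equally many steps, whereas \<open>goes_above\<close> and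
  \<open>goes_below\<close> compare them column by column. Past the end of the path the height stays
  constant.\<close>

definition height :: "path \<Rightarrow> nat \<Rightarrow> nat" where
  "height R k = count_list (take k R) North"

lemma height_0 [simp]: "height R 0 = 0"
  by (simp add: height_def)

lemma height_Suc: "height R (Suc k) = height R k + (if k < length R \<and> R ! k = North then 1 else 0)"
  by (cases "k < length R") (auto simp: height_def take_Suc_conv_app_nth)

lemma height_mono: "k \<le> l \<Longrightarrow> height R k \<le> height R l"
  by (rule lift_Suc_mono_le) (simp_all add: height_Suc)

lemma height_le: "height R k \<le> k"
  by (induction k) (auto simp: height_Suc)

lemma count_East_North: "count_list R East + count_list R North = length R"
proof (induction R)
  case (Cons s R)
  then show ?case by (cases s) auto
qed simp

lemma path_end_take:
  assumes "k \<le> length R"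
  shows "path_end (take k R) = (k - height R k, height R k)"
  using count_East_North[of "take k R"] assms by (simp add: path_end_def height_def)

lemma path_end_eqD:
  assumes "path_end R = (m, r)"
  shows "length R = m + r" "height R (m + r) = r"
  using assms count_East_North[of R] by (auto simp: path_end_def height_def)

lemma in_path_points_iff:
  "(e, h) \<in> path_points R \<longleftrightarrow> e + h \<le> length R \<and> height R (e + h) = h"
proof
  assume "(e, h) \<in> path_points R"
  then obtain k where k: "k \<le> length R" "(e, h) = path_end (take k R)"
    unfolding path_points_def by blast
  then have "e = k - height R k" "h = height R k" by (simp_all add: path_end_take)
  then have "e + h = k" using height_le[of R k] by simp
  then show "e + h \<le> length R \<and> height R (e + h) = h" using k \<open>h = height R k\<close> by simp
next
  assume *: "e + h \<le> length R \<and> height R (e + h) = h"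
  then have "path_end (take (e + h) R) = (e, h)" by (simp add: path_end_take)
  then show "(e, h) \<in> path_points R" using * unfolding path_points_def by force
qed

text \<open>A discrete intermediate value argument: the column \<open>k - height R k\<close> grows
  by 0 or 1 when \<open>k\<close> grows by 1.\<close>

lemma column_met:
  assumes "l \<le> u" "l - height R l \<le> e" "e \<le> u - height R u"
  shows "\<exists>k\<ge>l. k \<le> u \<and> k - height R k = e"
  using assms
proof (induction u)
  case 0
  then show ?case by auto
next
  case (Suc u)
  show ?case
  proof (cases "e = Suc u - height R (Suc u) \<or> l = Suc u")
    case True
    then show ?thesis using Suc.prems by (metis antisym order_refl)
  next
    case False
    then have "e \<le> u - height R u" "l \<le> u" using Suc.prems by (auto simp: height_Suc split: if_splits)
    then show ?thesis using Suc.IH Suc.prems(2) le_SucI by blast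
  qed
qed

lemma not_goes_above_iff:
  assumes R: "path_end R = (m, r)" and Q: "path_end Q = (m, r)"
  shows "\<not> goes_above R Q \<longleftrightarrow> (\<forall>k\<le>m + r. height R k \<le> height Q k)"
proof
  assume not_above: "\<not> goes_above R Q"
  show "\<forall>k\<le>m + r. height R k \<le> height Q k"
  proof (intro allI impI, rule ccontr)
    fix k assume k: "k \<le> m + r" "\<not> height R k \<le> height Q k"
    let ?e = "k - height R k"
    have "(?e, height R k) \<in> path_points R"
      using k height_le[of R k] path_end_eqD[OF R] by (simp add: in_path_points_iff)
    \<comment> \<open>A point of \<open>Q\<close> in this column at or above \<open>R\<close> would
      be reached \<open>d\<close> steps after \<open>k\<close> at height
      \<open>height R k + d\<close>. But \<open>Q\<close> is lower than \<open>R\<close> at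
      \<open>k\<close> and gains at most one per step.\<close>
    moreover have "h < height R k" if "(?e, h) \<in> path_points Q" for h
    proof (rule ccontr)
      assume "\<not> h < height R k"
      then obtain d where d: "h = height R k + d" by (metis le_Suc_ex not_less)
      then have k': "?e + h = k + d" using height_le[of R k] by simp
      have "height Q (k + d) \<le> height Q k + d"
        by (induction d) (auto simp: height_Suc)
      then show False using that k(2) d k' by (simp add: in_path_points_iff)
    qed
    ultimately show False using not_above unfolding goes_above_def by blast
  qed
next
  assume le: "\<forall>k\<le>m + r. height R k \<le> height Q k"
  show "\<not> goes_above R Q"
  proof
    assume "goes_above R Q"
    then obtain e h where eh: "(e, h) \<in> path_points R" "\<And>h'. (e, h') \<in> path_points Q \<Longrightarrow> h' < h"
      unfolding goes_above_def by blast
    have k: "e + h \<le> m + r" "height R (e + h) = h"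
      using eh(1) path_end_eqD[OF R] by (auto simp: in_path_points_iff)
    have "e \<le> m"
    proof -
      obtain d where d: "m + r = e + h + d" using k(1) le_Suc_ex by blast
      have "height R (e + h + d) \<le> height R (e + h) + d" by (induction d) (auto simp: height_Suc)
      then show ?thesis using path_end_eqD[OF R] d k(2) by simp
    qed
    \<comment> \<open>After \<open>e + h\<close> steps \<open>Q\<close> is at height at least
      \<open>h\<close>, so in column at most \<open>e\<close>. It ends in column \<open>m\<close>,
      hence it meets column \<open>e\<close> at a later or equal step, at height at least
      \<open>h\<close>.\<close>
    then obtain l where l: "e + h \<le> l" "l \<le> m + r" "l - height Q l = e"
      using column_met[of "e + h" "m + r" Q e] k le path_end_eqD[OF Q] by force
    have "e + height Q l = l" using l(3) height_le[of Q l] by linarith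
    then have "(e, height Q l) \<in> path_points Q"
      using l(2) path_end_eqD[OF Q] by (simp add: in_path_points_iff)
    moreover have "h \<le> height Q l" using le k height_mono[OF l(1), of Q] by force
    ultimately show False using eh(2) by force
  qed
qed

lemma not_goes_below_iff:
  assumes R: "path_end R = (m, r)" and P: "path_end P = (m, r)"
  shows "\<not> goes_below R P \<longleftrightarrow> (\<forall>k\<le>m + r. height P k \<le> height R k)"
proof
  assume not_below: "\<not> goes_below R P"
  show "\<forall>k\<le>m + r. height P k \<le> height R k"
  proof (intro allI impI, rule ccontr)
    fix k assume k: "k \<le> m + r" "\<not> height P k \<le> height R k"
    let ?e = "k - height R k"
    have "(?e, height R k) \<in> path_points R"
      using k height_le[of R k] path_end_eqD[OF R] by (simp add: in_path_points_iff)
    moreover have "height R k < h" if "(?e, h) \<in> path_points P" for h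
    proof (rule ccontr)
      assume "\<not> height R k < h"
      then obtain d where d: "height R k = h + d" by (metis le_Suc_ex not_less)
      then have k': "k = ?e + h + d" using height_le[of R k] by simp
      have "height P (?e + h + d) \<le> height P (?e + h) + d"
        by (induction d) (auto simp: height_Suc)
      then show False using that k(2) d k' by (simp add: in_path_points_iff)
    qed
    ultimately show False using not_below unfolding goes_below_def by blast
  qed
next
  assume le: "\<forall>k\<le>m + r. height P k \<le> height R k"
  show "\<not> goes_below R P"
  proof
    assume "goes_below R P"
    then obtain e h where eh: "(e, h) \<in> path_points R" "\<And>h'. (e, h') \<in> path_points P \<Longrightarrow> h < h'"
      unfolding goes_below_def by blast
    have k: "e + h \<le> m + r" "height R (e + h) = h"
      using eh(1) path_end_eqD[OF R] by (auto simp: in_path_points_iff)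
    then have "height P (e + h) \<le> h" using le by force
    then have "e \<le> e + h - height P (e + h)" by linarith
    \<comment> \<open>By step \<open>e + h\<close> the path \<open>P\<close> has gone from column 0
      to column \<open>e\<close> or beyond, so it met column \<open>e\<close> no later, at height at
      most \<open>h\<close>.\<close>
    then obtain l where l: "l \<le> e + h" "l - height P l = e"
      using column_met[of 0 "e + h" P e] by auto
    have "e + height P l = l" using l(2) height_le[of P l] by linarith
    then have "(e, height P l) \<in> path_points P"
      using l(1) k(1) path_end_eqD[OF P] by (simp add: in_path_points_iff)
    moreover have "height P l \<le> h"
      using height_mono[OF l(1), of P] \<open>height P (e + h) \<le> h\<close> by simp
    ultimately show False using eh(2) by force
  qed
qed

section \<open>The North step sets as intervals\<close>

lemma path_with_heights:
  assumes "g 0 = 0" "\<And>k. k < n \<Longrightarrow> g (Suc k) = g k \<or> g (Suc k) = Suc (g k)"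
  obtains R where "length R = n" "\<And>k. k \<le> n \<Longrightarrow> height R k = g k"
proof
  let ?R = "map (\<lambda>k. if g (Suc k) = g k then East else North) [0..<n]"
  show "length ?R = n" by simp
  show "height ?R k = g k" if "k \<le> n" for k
    using that
  proof (induction k)
    case (Suc k)
    then show ?case using assms(2)[of k] by (auto simp: height_Suc)
  qed (simp add: assms)
qed

text \<open>An \<open>i\<close>-th North step at \<open>j\<close> leads from height
  \<open>i - 1\<close> to height \<open>i\<close>. The lower path \<open>P\<close> must permit the
  first height and the upper path \<open>Q\<close> the second; any such step extends to a path
  between them.\<close>

lemma north_set_eq:
  assumes P: "path_end P = (m, r)" and Q: "path_end Q = (m, r)" and above: "\<not> goes_above P Q"
    and i: "1 \<le> i" "i \<le> r"
  shows "north_set m r P Q i = {j. 1 \<le> j \<and> j \<le> m + r \<and> height P (j - 1) < i \<and> i \<le> height Q j}"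
    (is "_ = ?J")
proof
  have PQ: "height P k \<le> height Q k" if "k \<le> m + r" for k
    using above not_goes_above_iff[OF P Q] that by blast
  show "north_set m r P Q i \<subseteq> ?J"
  proof
    fix j assume "j \<in> north_set m r P Q i"
    then obtain R where R: "R \<in> paths_between m r P Q" "ith_north_step R i j"
      unfolding north_set_def by blast
    have end_R: "path_end R = (m, r)" using R(1) by (simp add: paths_between_def)
    have le: "height P k \<le> height R k" "height R k \<le> height Q k" if "k \<le> m + r" for k
      using R(1) that not_goes_above_iff[OF end_R Q] not_goes_below_iff[OF end_R P]
      by (auto simp: paths_between_def)
    have j: "1 \<le> j" "j \<le> m + r" "height R j = i" "R ! (j - 1) = North"
      using R(2) path_end_eqD[OF end_R] by (auto simp: ith_north_step_def height_def)
    then have "Suc (height R (j - 1)) = i"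
      using height_Suc[of R "j - 1"] path_end_eqD[OF end_R] by simp
    moreover have "height P (j - 1) \<le> height R (j - 1)"
      by (rule le(1)) (use j(2) in linarith)
    ultimately show "j \<in> ?J" using j le(2)[of j] by simp
  qed
  show "?J \<subseteq> north_set m r P Q i"
  proof
    fix j assume "j \<in> ?J"
    then obtain j' where j: "j = Suc j'" "Suc j' \<le> m + r" "height P j' < i" "i \<le> height Q (Suc j')"
      by (cases j) auto
    \<comment> \<open>The path follows \<open>Q\<close> up to height \<open>i - 1\<close>, stays there until step \<open>j\<close>, rises
      to height \<open>i\<close>, and stays there until it meets \<open>P\<close>.\<close>
    define g where "g k = (if k \<le> j' then min (height Q k) (i - 1) else max (height P k) i)" for k
    \<comment> \<open>As heights gain at most one per step, \<open>Q\<close> has reached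
      \<open>i - 1\<close> at \<open>j'\<close> and \<open>P\<close> has not passed \<open>i\<close>
      at \<open>Suc j'\<close>.\<close>
    have gj: "g j' = i - 1" "g (Suc j') = i"
      using j height_Suc[of Q j'] height_Suc[of P j'] by (auto simp: g_def split: if_splits)
    have "g (Suc k) = g k \<or> g (Suc k) = Suc (g k)" for k
    proof (cases "k = j'")
      case True
      then show ?thesis using gj i by simp
    next
      case False
      then show ?thesis using height_Suc[of Q k] height_Suc[of P k] by (auto simp: g_def split: if_splits)
    qed
    moreover have "g 0 = 0" by (simp add: g_def)
    ultimately obtain R where R: "length R = m + r" "\<And>k. k \<le> m + r \<Longrightarrow> height R k = g k"
      using path_with_heights[of g "m + r"] by blast
    have "g (m + r) = r" using j path_end_eqD[OF P] i by (auto simp: g_def)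
    then have end_R: "path_end R = (m, r)" using R path_end_take[of "m + r" R] by simp
    have "g k \<le> height Q k" if "k \<le> m + r" for k
    proof (cases "k \<le> j'")
      case False
      then have "height Q (Suc j') \<le> height Q k" by (intro height_mono) simp
      then show ?thesis using False j PQ[OF that] by (auto simp: g_def)
    qed (simp add: g_def)
    moreover have "height P k \<le> g k" if "k \<le> m + r" for k
    proof (cases "k \<le> j'")
      case True
      then have "height P k \<le> height P j'" by (rule height_mono)
      then show ?thesis using True j PQ[OF that] by (auto simp: g_def)
    qed (simp add: g_def)
    ultimately have "R \<in> paths_between m r P Q"
      using end_R R(2) not_goes_above_iff[OF end_R Q] not_goes_below_iff[OF end_R P]
      by (simp add: paths_between_def)
    moreover have "ith_north_step R i j"
      using gj R i height_Suc[of R j'] j(1,2)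
      by (auto simp: ith_north_step_def height_def[symmetric] split: if_splits)
    ultimately show "j \<in> north_set m r P Q i" unfolding north_set_def by blast
  qed
qed

text \<open>For \<open>1 \<le> i \<le> r\<close>, with \<open>r\<close> the final height, this is
  the number of the \<open>i\<close>-th North step, counted from 1. As a least element it is adjoint
  to \<open>height\<close>, which yields the facts below.\<close>

definition north_pos :: "path \<Rightarrow> nat \<Rightarrow> nat" where
  "north_pos R i = (LEAST k. i \<le> height R k)"

lemma north_pos_le_iff:
  assumes "path_end R = (m, r)" "i \<le> r"
  shows "north_pos R i \<le> k \<longleftrightarrow> i \<le> height R k"
proof
  have "i \<le> height R (m + r)" using path_end_eqD[OF assms(1)] assms(2) by simp
  then have "i \<le> height R (north_pos R i)" unfolding north_pos_def by (rule LeastI)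
  then show "i \<le> height R k" if "north_pos R i \<le> k" using height_mono[OF that, of R] by simp
qed (simp add: north_pos_def Least_le)

lemma height_north_pos:
  assumes "path_end R = (m, r)" "i \<le> r"
  shows "height R (north_pos R i) = i"
proof (cases "north_pos R i")
  case 0
  then show ?thesis using north_pos_le_iff[OF assms, of 0] by simp
next
  case (Suc k)
  then show ?thesis
    using north_pos_le_iff[OF assms, of k] north_pos_le_iff[OF assms, of "Suc k"] height_Suc[of R k]
    by (auto split: if_splits)
qed

lemma north_pos_less:
  assumes "path_end R = (m, r)" "i < j" "j \<le> r"
  shows "north_pos R i < north_pos R j"
  using north_pos_le_iff[OF assms(1,3), of "north_pos R i"] height_north_pos[OF assms(1), of i] assms(2,3)
  by simp

lemma north_pos_bounds:
  assumes "path_end R = (m, r)" "1 \<le> i" "i \<le> r"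
  shows "1 \<le> north_pos R i" "north_pos R i \<le> m + r"
  using north_pos_le_iff[OF assms(1,3), of 0] north_pos_le_iff[OF assms(1,3), of "m + r"]
    path_end_eqD[OF assms(1)] assms(2,3) by auto

text \<open>By the adjunction the two height conditions become bounds on \<open>j\<close>. The upper
  path takes its North steps earlier, so \<open>Q\<close> gives the left endpoint.\<close>

lemma north_set_interval:
  assumes P: "path_end P = (m, r)" and Q: "path_end Q = (m, r)" and above: "\<not> goes_above P Q"
    and i: "1 \<le> i" "i \<le> r"
  shows "north_set m r P Q i = {north_pos Q i..north_pos P i}"
proof -
  have "(1 \<le> j \<and> j \<le> m + r \<and> height P (j - 1) < i \<and> i \<le> height Q j) \<longleftrightarrow>
      north_pos Q i \<le> j \<and> j \<le> north_pos P i" for j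
  proof -
    have "height P (j - 1) < i \<longleftrightarrow> j - 1 < north_pos P i"
      using north_pos_le_iff[OF P i(2), of "j - 1"] by (meson not_le)
    moreover have "i \<le> height Q j \<longleftrightarrow> north_pos Q i \<le> j"
      using north_pos_le_iff[OF Q i(2)] by simp
    ultimately show ?thesis
      using north_pos_bounds[OF P i] north_pos_bounds[OF Q i] by (cases j) auto
  qed
  then show ?thesis
    unfolding north_set_eq[OF assms] by (intro set_eqI) (simp only: mem_Collect_eq atLeastAtMost_iff)
qed

text \<open>Covers rank 0 in the final statement, where the sets of index 1 and \<open>r\<close> are
  still mentioned.\<close>

lemma north_set_0: "north_set m 0 P Q i = {}"
proof -
  have "\<not> ith_north_step R i j" if "path_end R = (m, 0)" for R j
    using that path_end_eqD[OF that] count_list_0_iff[of R North]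
    by (auto simp: ith_north_step_def path_end_def in_set_conv_nth)
  then show ?thesis by (auto simp: north_set_def paths_between_def)
qed

theorem theorem3p6:
  fixes m r x :: nat and P Q :: path
  assumes "path_end P = (m, r)" and "path_end Q = (m, r)"
    and "\<not> goes_above P Q"
    and "connected_matroid (lattice_path_matroid m r P Q)"
    and "card (ground (lattice_path_matroid m r P Q)) \<ge> 2"
    and "x \<in> ground (lattice_path_matroid m r P Q)"
  shows "(\<exists>C. circuit (lattice_path_matroid m r P Q) C
              \<and> spanning (lattice_path_matroid m r P Q) C \<and> x \<in> C) \<longleftrightarrow>
         card {i \<in> {1..r}. x \<in> north_set m r P Q i} \<ge> 2
         \<or> x \<in> north_set m r P Q 1 \<or> x \<in> north_set m r P Q r"
proof -
  note N = north_set_interval[OF assms(1-3)]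
  interpret interval_presentation "m + r" r "north_pos Q" "north_pos P"
  proof
    fix i assume i: "1 \<le> i" "i \<le> r"
    \<comment> \<open>When \<open>P\<close> reaches height \<open>i\<close>, the path
      \<open>Q\<close> above it has already done so.\<close>
    have "height P (north_pos P i) \<le> height Q (north_pos P i)"
      using not_goes_above_iff[OF assms(1,2)] assms(3) north_pos_bounds(2)[OF assms(1) i] by blast
    then show "north_pos Q i \<le> north_pos P i"
      using north_pos_le_iff[OF assms(2) i(2)] height_north_pos[OF assms(1) i(2)] by simp
  qed (use north_pos_less[OF assms(1)] north_pos_less[OF assms(2)]
      north_pos_bounds[OF assms(1)] north_pos_bounds[OF assms(2)] in blast)+
  have M: "lattice_path_matroid m r P Q = M"
    unfolding lattice_path_matroid_def M_def by (rule transversal_matroid_cong) (use N in simp)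
  have ground: "ground M = {1..m + r}" by (simp add: M_def)
  have "{i \<in> {1..r}. x \<in> north_set m r P Q i} = {i \<in> {1..r}. x \<in> {north_pos Q i..north_pos P i}}"
    using N by auto
  moreover have "x \<in> north_set m r P Q i \<longleftrightarrow> 1 \<le> r \<and> x \<in> {north_pos Q i..north_pos P i}"
    if "i = 1 \<or> i = r" for i
    using that N[of i] north_set_0 by (cases "r = 0") auto
  ultimately show ?thesis
    using in_spanning_circuit_iff[of x] assms(4-6) unfolding M ground by auto
qed

end
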